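(* Every AL-monoid $(A,+,\vee,\wedge,\ast,0)$ is a representable autometrized algebra, i.e. $(A,+,\leq,\ast)$, with $\leq$ the lattice order, is a representable autometrized algebra.
   Context: A commutative lattice ordered monoid $(A,+,\vee,\wedge,0)$ is a commutative monoid $(A,+)$ with identity element $0$ together with a lattice structure $(A,\vee,\wedge)$ such that $a+(b\vee c)=(a+b)\vee(a+c)$ and $a+(b\wedge c)=(a+b)\wedge(a+c)$ for all $a,b,c\in A$; $\leq$ denotes the lattice order. The element $0$ is not assumed to be the least element of $A$. An autometrized lattice ordered monoid (AL-monoid) is an algebra $(A,+,\vee,\wedge,\ast,0)$ of arity $(2,2,2,2,0)$ such that: (1) $(A,+,\vee,\wedge,0)$ is a commutative lattice ordered monoid; (2) $a\ast(a\wedge b)+b=a\vee b$ for all $a,b\in A$ (here $a\ast(a\wedge b)+b$ means $(a\ast(a\wedge b))+b$); (3) for each $a\in A$, the mappings $x\mapsto a+x$, $x\mapsto a\vee x$, $x\mapsto a\wedge x$ and $x\mapsto a\ast x$ are contractions with respect to $\ast$, where $f:A\to A$ is a contraction if $f(x)\ast f(y)\leq x\ast y$ for all $x,y\in A$; (4) $[a\ast(a\vee b)]\wedge[b\ast(a\vee b)]=0$ for all $a,b\in A$. A lattice ordered autometrized algebra is a system $(A,+,\leq,\ast)$ such that $(A,+,\leq)$ is a commutative lattice ordered semigroup with $0$ (a commutative lattice ordered monoid with identity $0$ in the sense above) and $\ast:A\times A\to A$ is a metric operation: (a) $a\ast b\geq 0$ for all $a,b\in A$, with equality if and only if $a=b$;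 (b) $a\ast b=b\ast a$ for all $a,b\in A$; (c) $a\ast b\leq a\ast c+c\ast b$ for all $a,b,c\in A$. A lattice ordered autometrized algebra is called a representable autometrized algebra if (1) it is semiregular: $a\in A$ and $a\geq 0$ imply $a\ast 0=a$; and (2) for every $a\in A$ the mappings $x\mapsto a+x$, $x\mapsto a\vee x$, $x\mapsto a\wedge x$ and $x\mapsto a\ast x$ are contractions, i.e. if $\theta$ denotes any of $+,\wedge,\vee,\ast$, then $(a\,\theta\, x)\ast(a\,\theta\, y)\leq x\ast y$ for all $x,y\in A$. *)

theory Defs
  imports Main
begin

text \<open>
  The carrier of each structure is a whole type, so a statement polymorphic in the type ranges
  over all carriers. Operations are explicit locale parameters; the lattice is given
  algebraically by \<open>join\<close> and \<open>meet\<close>, and its order is derived from \<open>meet\<close>.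
\<close>

locale comm_lattice_ordered_monoid =
  comm_monoid plus zero + join: semilattice join + meet: semilattice meet
  for plus :: "'a \<Rightarrow> 'a \<Rightarrow> 'a"  (infixl "\<oplus>" 65)
    and zero :: 'a  ("\<zero>")
    and join :: "'a \<Rightarrow> 'a \<Rightarrow> 'a"  (infixl "\<squnion>" 65)
    and meet :: "'a \<Rightarrow> 'a \<Rightarrow> 'a"  (infixl "\<sqinter>" 70) +
  assumes join_meet_absorb: "a \<squnion> (a \<sqinter> b) = a"
    and meet_join_absorb: "a \<sqinter> (a \<squnion> b) = a"
    and plus_join_distrib: "a \<oplus> (b \<squnion> c) = (a \<oplus> b) \<squnion> (a \<oplus> c)"
    and plus_meet_distrib: "a \<oplus> (b \<sqinter> c) = (a \<oplus> b) \<sqinter> (a \<oplus> c)"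
begin

definition le :: "'a \<Rightarrow> 'a \<Rightarrow> bool"  (infix "\<sqsubseteq>" 50)
  where "a \<sqsubseteq> b \<longleftrightarrow> a \<sqinter> b = a"

lemma le_is_lattice_order: "class.lattice (\<sqinter>) (\<sqsubseteq>) (\<lambda>a b. a \<sqsubseteq> b \<and> a \<noteq> b) (\<squnion>)"
proof -
  have iff: "a \<sqsubseteq> b \<longleftrightarrow> a \<squnion> b = b" for a b
    unfolding le_def by (metis join_meet_absorb meet_join_absorb join.commute meet.commute)
  show ?thesis
  proof
    show "x \<sqsubseteq> y \<and> x \<noteq> y \<longleftrightarrow> x \<sqsubseteq> y \<and> \<not> y \<sqsubseteq> x" for x y
      unfolding le_def by (metis meet.commute meet.idem)
    show "x \<sqsubseteq> x" for x by (simp add: le_def)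
    show "x \<sqsubseteq> y \<Longrightarrow> y \<sqsubseteq> z \<Longrightarrow> x \<sqsubseteq> z" for x y z
      unfolding le_def by (metis meet.assoc)
    show "x \<sqsubseteq> y \<Longrightarrow> y \<sqsubseteq> x \<Longrightarrow> x = y" for x y
      unfolding le_def by (metis meet.commute)
    show "x \<sqinter> y \<sqsubseteq> x" for x y
      unfolding le_def by (simp add: meet.commute)
    show "x \<sqinter> y \<sqsubseteq> y" for x y
      unfolding le_def by (simp add: meet.assoc)
    show "x \<sqsubseteq> y \<Longrightarrow> x \<sqsubseteq> z \<Longrightarrow> x \<sqsubseteq> y \<sqinter> z" for x y z
      unfolding le_def by (metis meet.assoc)
    show "x \<sqsubseteq> x \<squnion> y" for x y
      unfolding le_def by (simp add: meet_join_absorb)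
    show "y \<sqsubseteq> x \<squnion> y" for x y
      unfolding le_def by (metis meet_join_absorb join.commute)
    show "y \<sqsubseteq> x \<Longrightarrow> z \<sqsubseteq> x \<Longrightarrow> y \<squnion> z \<sqsubseteq> x" for x y z
      unfolding iff by (metis join.assoc)
  qed
qed

definition contraction :: "('a \<Rightarrow> 'a \<Rightarrow> 'a) \<Rightarrow> ('a \<Rightarrow> 'a) \<Rightarrow> bool"
  where "contraction star f \<longleftrightarrow> (\<forall>x y. star (f x) (f y) \<sqsubseteq> star x y)"

end

locale AL_monoid =
  comm_lattice_ordered_monoid plus zero join meet
  for plus :: "'a \<Rightarrow> 'a \<Rightarrow> 'a"  (infixl "\<oplus>" 65)
    and zero :: 'a  ("\<zero>")
    and join :: "'a \<Rightarrow> 'a \<Rightarrow> 'a"  (infixl "\<squnion>" 65)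
    and meet :: "'a \<Rightarrow> 'a \<Rightarrow> 'a"  (infixl "\<sqinter>" 70) +
  fixes star :: "'a \<Rightarrow> 'a \<Rightarrow> 'a"  (infixl "\<star>" 75)
  assumes star_meet_plus: "(a \<star> (a \<sqinter> b)) \<oplus> b = a \<squnion> b"
    and contraction_plus: "contraction (\<star>) (\<lambda>x. a \<oplus> x)"
    and contraction_join: "contraction (\<star>) (\<lambda>x. a \<squnion> x)"
    and contraction_meet: "contraction (\<star>) (\<lambda>x. a \<sqinter> x)"
    and contraction_star: "contraction (\<star>) (\<lambda>x. a \<star> x)"
    and star_join_disjoint: "(a \<star> (a \<squnion> b)) \<sqinter> (b \<star> (a \<squnion> b)) = \<zero>"

text \<open>
  A lattice ordered autometrized algebra is written \<open>(A, +, \<le>, \<star>)\<close>. Its parameters here are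
  \<open>zero\<close>, \<open>join\<close> and \<open>meet\<close> instead of \<open>\<le>\<close>: the identity is determined by \<open>plus\<close>, and the
  lattice operations and the lattice order determine each other.
\<close>

locale lattice_ordered_autometrized_algebra =
  comm_lattice_ordered_monoid plus zero join meet
  for plus :: "'a \<Rightarrow> 'a \<Rightarrow> 'a"  (infixl "\<oplus>" 65)
    and zero :: 'a  ("\<zero>")
    and join :: "'a \<Rightarrow> 'a \<Rightarrow> 'a"  (infixl "\<squnion>" 65)
    and meet :: "'a \<Rightarrow> 'a \<Rightarrow> 'a"  (infixl "\<sqinter>" 70) +
  fixes star :: "'a \<Rightarrow> 'a \<Rightarrow> 'a"  (infixl "\<star>" 75)
  assumes star_nonneg: "\<zero> \<sqsubseteq> a \<star> b"
    and star_eq_zero_iff: "a \<star> b = \<zero> \<longleftrightarrow> a = b"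
    and star_commute: "a \<star> b = b \<star> a"
    and star_triangle: "a \<star> b \<sqsubseteq> (a \<star> c) \<oplus> (c \<star> b)"

locale representable_autometrized_algebra =
  lattice_ordered_autometrized_algebra plus zero join meet star
  for plus :: "'a \<Rightarrow> 'a \<Rightarrow> 'a"  (infixl "\<oplus>" 65)
    and zero :: 'a  ("\<zero>")
    and join :: "'a \<Rightarrow> 'a \<Rightarrow> 'a"  (infixl "\<squnion>" 65)
    and meet :: "'a \<Rightarrow> 'a \<Rightarrow> 'a"  (infixl "\<sqinter>" 70)
    and star :: "'a \<Rightarrow> 'a \<Rightarrow> 'a"  (infixl "\<star>" 75) +
  assumes semiregular: "\<zero> \<sqsubseteq> a \<Longrightarrow> a \<star> \<zero> = a"
    and contraction_plus: "contraction (\<star>) (\<lambda>x. a \<oplus> x)"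
    and contraction_join: "contraction (\<star>) (\<lambda>x. a \<squnion> x)"
    and contraction_meet: "contraction (\<star>) (\<lambda>x. a \<sqinter> x)"
    and contraction_star: "contraction (\<star>) (\<lambda>x. a \<star> x)"

end

theory Submission
  imports Defs
begin

text \<open>
  Semiregularity is axiom (2) with \<open>b = \<zero>\<close>. Since \<open>a \<star> a = \<zero>\<close>, contracting by \<open>x \<mapsto> a \<star> x\<close> gives
  \<open>a \<star> b = (a \<star> b) \<star> (a \<star> a) \<sqsubseteq> b \<star> a\<close>, which is symmetry. For the triangle inequality put
  \<open>u = a \<star> b\<close> and \<open>v = c \<star> b\<close>: then \<open>u \<star> v \<sqsubseteq> a \<star> c\<close> by contraction, and
  \<open>u \<sqsubseteq> u \<squnion> v = u \<star> (u \<sqinter> v) \<oplus> v \<sqsubseteq> u \<star> v \<oplus> v\<close>.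
\<close>

context comm_lattice_ordered_monoid
begin

interpretation order: lattice "(\<sqinter>)" "(\<sqsubseteq>)" "\<lambda>a b. a \<sqsubseteq> b \<and> a \<noteq> b" "(\<squnion>)"
  by (rule le_is_lattice_order)

lemmas le_trans = order.order.trans
  and le_antisym = order.order.antisym
  and le_join1 = order.sup_ge1

lemma plus_right_mono: "a \<sqsubseteq> b \<Longrightarrow> a \<oplus> c \<sqsubseteq> b \<oplus> c"
  unfolding le_def by (metis plus_meet_distrib commute)

end

context AL_monoid
begin

lemma star_star_le: "(a \<star> x) \<star> (a \<star> y) \<sqsubseteq> x \<star> y"
  using contraction_star by (simp add: contraction_def)

lemma meet_star_meet_le: "(a \<sqinter> x) \<star> (a \<sqinter> y) \<sqsubseteq> x \<star> y"
  using contraction_meet by (simp add: contraction_def)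

lemma star_self: "a \<star> a = \<zero>"
  using star_join_disjoint[of a a] by simp

text \<open>Meeting with \<open>a \<sqinter> b\<close> is a contraction that collapses
  \<open>a\<close> and \<open>b\<close> to one point, whose distance to itself is
  \<open>\<zero>\<close>.\<close>

lemma star_nonneg: "\<zero> \<sqsubseteq> a \<star> b"
proof -
  have "(a \<sqinter> b) \<sqinter> a = (a \<sqinter> b) \<sqinter> b"
    by (metis meet.assoc meet.commute meet.idem)
  then show ?thesis
    using meet_star_meet_le[of "a \<sqinter> b" a b] by (simp add: star_self)
qed

lemma star_zero: "\<zero> \<sqsubseteq> a \<Longrightarrow> a \<star> \<zero> = a"
  using star_meet_plus[of a \<zero>] join_meet_absorb[of a \<zero>]
  by (simp add: le_def meet.commute)

lemma star_commute: "a \<star> b = b \<star> a"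
proof -
  have "x \<star> y \<sqsubseteq> y \<star> x" for x y
    using star_star_le[of x y x] by (simp add: star_self star_zero star_nonneg)
  then show ?thesis
    by (blast intro: le_antisym)
qed

text \<open>Bounds the term of axiom (2) by a distance: meeting with \<open>a\<close> fixes
  \<open>a\<close>.\<close>

lemma star_meet_le: "a \<star> (a \<sqinter> b) \<sqsubseteq> a \<star> b"
  using meet_star_meet_le[of a a b] by simp

text \<open>At distance \<open>\<zero>\<close>, the term \<open>a \<star> (a \<sqinter> b)\<close>
  is squeezed to \<open>\<zero>\<close>, so axiom (2) gives \<open>a \<squnion> b = b\<close>;
  symmetry gives \<open>a \<squnion> b = a\<close>.\<close>

lemma star_eq_zero_iff: "a \<star> b = \<zero> \<longleftrightarrow> a = b"
proof
  have join_eq: "x \<squnion> y = y" if "x \<star> y = \<zero>" for x y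
  proof -
    have "x \<star> (x \<sqinter> y) = \<zero>"
      using star_meet_le[of x y] unfolding that by (rule le_antisym) (rule star_nonneg)
    then show ?thesis
      using star_meet_plus[of x y] by simp
  qed
  assume "a \<star> b = \<zero>"
  then show "a = b"
    using join_eq[of a b] join_eq[of b a] by (simp add: star_commute join.commute)
qed (simp add: star_self)

lemma star_triangle: "a \<star> b \<sqsubseteq> (a \<star> c) \<oplus> (c \<star> b)"
proof -
  let ?u = "a \<star> b" and ?v = "c \<star> b"
  have "?u \<star> ?v \<sqsubseteq> a \<star> c"
    using star_star_le[of b a c] by (simp add: star_commute)
  then have "(?u \<star> (?u \<sqinter> ?v)) \<oplus> ?v \<sqsubseteq> (a \<star> c) \<oplus> ?v"
    by (blast intro: plus_right_mono le_trans star_meet_le)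
  then show ?thesis
    unfolding star_meet_plus by (blast intro: le_trans le_join1)
qed

lemma representable: "representable_autometrized_algebra plus zero join meet star"
  by unfold_locales
    (fact star_nonneg star_eq_zero_iff star_commute star_triangle star_zero
      contraction_plus contraction_join contraction_meet contraction_star)+

end

theorem theorem2p2:
  fixes plus join meet star :: "'a \<Rightarrow> 'a \<Rightarrow> 'a" and zero :: 'a
  assumes "AL_monoid plus zero join meet star"
  shows "representable_autometrized_algebra plus zero join meet star"
  using assms by (rule AL_monoid.representable)

end
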